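(* Let $k$ be a non-archimedean local field with valuation ring $\mathcal{O}$ and uniformizer $\pi$, $V=k^n$ with standard basis $e_1,\dots,e_n$, and $M_n(k)=\mathrm{End}_k(V)$. Call a set $P$ of maximal orders of $M_n(k)$ a convex polytope in an apartment if there exist $\gamma\in GL_n(k)$ and $\boldsymbol{\nu}\in M_n(\mathbb{Z})$ with $C(\boldsymbol{\nu})$ reduced such that $P=\{\mathrm{End}_{\mathcal{O}}(\gamma(\bigoplus_i\mathcal{O}\pi^{m_i}e_i)): m\in C(\boldsymbol{\nu})\cap(\{0\}\times\mathbb{Z}^{n-1})\}$. Then $P\mapsto\bigcap_{\Lambda\in P}\Lambda$ is a one-to-one correspondence between convex polytopes in apartments of the affine building of $SL_n(k)$ and split orders in $M_n(k)$.
   Context: An order is a subring of $M_n(k)$ containing $1$ which is a free $\mathcal{O}$-module of rank $n^2$; a split order is an order containing $\gamma R\gamma^{-1}$ for some $\gamma\in GL_n(k)$, where $R=\{\mathrm{diag}(d_1,\dots,d_n):d_i\in\mathcal{O}\}$. For $\boldsymbol{\nu}=(\nu_{ij})\in M_n(\mathbb{Z})$, $C(\boldsymbol{\nu})$ is the set of $x\in\mathbb{R}^n$ with $x_1=0$ and $-\nu_{ji}\le x_i-x_j\le\nu_{ij}$ for all $i,j$; it is reduced if it contains a point of $\{0\}\times\mathbb{Z}^{n-1}$ and every hyperplane $x_i-x_j=\nu_{ij}$ meets it. The vertices of the affine building of $SL_n(k)$ are homothety classes of lattices $L\subset V$, identified with maximal orders $\mathrm{End}_{\mathcal{O}}(L)$;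 the apartment attached to a basis $\{f_i\}=\{\gamma e_i\}$ consists of the classes of $\bigoplus_i\mathcal{O}\pi^{a_i}f_i$, $a_i\in\mathbb{Z}$. *)

theory Defs
  imports "Jordan_Normal_Form.Matrix" "HOL-Algebra.Subrings"
begin

section \<open>Non-archimedean local fields\<close>

text \<open>A discrete valuation is a function \<open>v\<close> with integer values; its value at \<open>0\<close>
  (mathematically \<open>+\<infinity>\<close>) is left unconstrained, so every use of \<open>v x\<close> is guarded by \<open>x \<noteq> 0\<close>.
  The set \<open>frac_ideal v N\<close> is the \<open>N\<close>-th power of the maximal ideal; for varying \<open>N\<close> these
  sets form a neighbourhood basis of \<open>0\<close>.\<close>

definition frac_ideal :: "('k::field \<Rightarrow> int) \<Rightarrow> int \<Rightarrow> 'k set" where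
  "frac_ideal v N = {x. x = 0 \<or> N \<le> v x}"

definition valuation_ring :: "('k::field \<Rightarrow> int) \<Rightarrow> 'k set" where
  "valuation_ring v = frac_ideal v 0"

definition uniformizer :: "('k::field \<Rightarrow> int) \<Rightarrow> 'k \<Rightarrow> bool" where
  "uniformizer v \<pi> \<longleftrightarrow> \<pi> \<noteq> 0 \<and> v \<pi> = 1"

text \<open>A non-archimedean local field: complete with respect to a normalized discrete valuation
  (assumption \<open>normalized\<close> makes the value group all of the integers), with finite residue field.\<close>

locale nonarch_local_field =
  fixes v :: "'k::field \<Rightarrow> int"
  assumes val_mult: "x \<noteq> 0 \<Longrightarrow> y \<noteq> 0 \<Longrightarrow> v (x * y) = v x + v y"
    and val_add: "x \<noteq> 0 \<Longrightarrow> y \<noteq> 0 \<Longrightarrow> x + y \<noteq> 0 \<Longrightarrow> min (v x) (v y) \<le> v (x + y)"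
    and normalized: "\<exists>\<pi>. uniformizer v \<pi>"
    and complete: "\<And>X :: nat \<Rightarrow> 'k.
          (\<And>N. \<exists>M. \<forall>i\<ge>M. \<forall>j\<ge>M. X i - X j \<in> frac_ideal v N) \<Longrightarrow>
          \<exists>l. \<forall>N. \<exists>M. \<forall>i\<ge>M. X i - l \<in> frac_ideal v N"
    and finite_residue_field:
      "finite (valuation_ring v //
         {(x, y). x \<in> valuation_ring v \<and> y \<in> valuation_ring v \<and> x - y \<in> frac_ideal v 1})"

section \<open>Orders in the matrix algebra\<close>

abbreviation matrix_ring :: "nat \<Rightarrow> 'k::field mat ring" where
  "matrix_ring n \<equiv> ring_mat TYPE('k) n ()"

text \<open>\<open>S\<close> is a free submodule, over the valuation ring, of rank \<open>r\<close>: it has a basis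
  \<open>B 0, \<dots>, B (r - 1)\<close>.\<close>

definition free_of_rank :: "('k::field \<Rightarrow> int) \<Rightarrow> nat \<Rightarrow> nat \<Rightarrow> 'k mat set \<Rightarrow> bool" where
  "free_of_rank v n r S \<longleftrightarrow>
     (\<exists>B \<in> {..<r} \<rightarrow> carrier_mat n n.
        bij_betw (\<lambda>c. finsum (matrix_ring n) (\<lambda>l. c l \<cdot>\<^sub>m B l) {..<r})
          ({..<r} \<rightarrow>\<^sub>E valuation_ring v) S)"

definition is_order :: "('k::field \<Rightarrow> int) \<Rightarrow> nat \<Rightarrow> 'k mat set \<Rightarrow> bool" where
  "is_order v n S \<longleftrightarrow> subring S (matrix_ring n) \<and> free_of_rank v n (n\<^sup>2) S"

definition is_maximal_order :: "('k::field \<Rightarrow> int) \<Rightarrow> nat \<Rightarrow> 'k mat set \<Rightarrow> bool" where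
  "is_maximal_order v n S \<longleftrightarrow>
     is_order v n S \<and> (\<forall>T. is_order v n T \<longrightarrow> S \<subseteq> T \<longrightarrow> T = S)"

definition diagonal_ring :: "('k::field \<Rightarrow> int) \<Rightarrow> nat \<Rightarrow> 'k mat set" where
  "diagonal_ring v n = {mat_diag n d | d. \<forall>i<n. d i \<in> valuation_ring v}"

definition is_split_order :: "('k::field \<Rightarrow> int) \<Rightarrow> nat \<Rightarrow> 'k mat set \<Rightarrow> bool" where
  "is_split_order v n S \<longleftrightarrow> is_order v n S \<and>
     (\<exists>\<gamma> \<in> Units (matrix_ring n).
        {\<gamma> * d * inv\<^bsub>matrix_ring n\<^esub> \<gamma> | d. d \<in> diagonal_ring v n} \<subseteq> S)"

section \<open>Convex polytopes in apartments\<close>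

text \<open>Indices run over \<open>0, \<dots>, n - 1\<close>, so the normalization that the first coordinate of a
  point vanishes concerns coordinate \<open>0\<close>.\<close>

definition polytope :: "nat \<Rightarrow> int mat \<Rightarrow> real vec set" where
  "polytope n \<nu> = {x \<in> carrier_vec n. x $ 0 = 0 \<and>
     (\<forall>i<n. \<forall>j<n. - of_int (\<nu> $$ (j, i)) \<le> x $ i - x $ j \<and> x $ i - x $ j \<le> of_int (\<nu> $$ (i, j)))}"

definition lattice_points :: "nat \<Rightarrow> int vec set" where
  "lattice_points n = {m \<in> carrier_vec n. m $ 0 = 0}"

definition polytope_lattice_points :: "nat \<Rightarrow> int mat \<Rightarrow> int vec set" where
  "polytope_lattice_points n \<nu> = {m \<in> lattice_points n. map_vec of_int m \<in> polytope n \<nu>}"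

text \<open>For \<open>i = j\<close> the ``hyperplane'' is empty unless the diagonal entry is \<open>0\<close>; hence a reduced
  matrix has zero diagonal.\<close>

definition is_reduced :: "nat \<Rightarrow> int mat \<Rightarrow> bool" where
  "is_reduced n \<nu> \<longleftrightarrow> polytope_lattice_points n \<nu> \<noteq> {} \<and>
     (\<forall>i<n. \<forall>j<n. polytope n \<nu> \<inter> {x. x $ i - x $ j = of_int (\<nu> $$ (i, j))} \<noteq> {})"

definition coordinate_lattice :: "('k::field \<Rightarrow> int) \<Rightarrow> 'k \<Rightarrow> nat \<Rightarrow> int vec \<Rightarrow> 'k vec set" where
  "coordinate_lattice v \<pi> n m =
     {vec n (\<lambda>i. a i * \<pi> powi (m $ i)) | a. \<forall>i<n. a i \<in> valuation_ring v}"

text \<open>Every endomorphism of a lattice of full rank extends uniquely to the ambient space, so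
  the endomorphism ring is identified with the set of matrices preserving the lattice.\<close>

definition lattice_End :: "nat \<Rightarrow> 'k::field vec set \<Rightarrow> 'k mat set" where
  "lattice_End n L = {A \<in> carrier_mat n n. \<forall>x\<in>L. A *\<^sub>v x \<in> L}"

definition is_convex_polytope_in_apartment ::
  "('k::field \<Rightarrow> int) \<Rightarrow> 'k \<Rightarrow> nat \<Rightarrow> 'k mat set set \<Rightarrow> bool" where
  "is_convex_polytope_in_apartment v \<pi> n P \<longleftrightarrow>
     (\<forall>\<Lambda>\<in>P. is_maximal_order v n \<Lambda>) \<and>
     (\<exists>\<gamma> \<in> Units (matrix_ring n). \<exists>\<nu> \<in> carrier_mat n n. is_reduced n \<nu> \<and>
        P = {lattice_End n ((*\<^sub>v) \<gamma> ` coordinate_lattice v \<pi> n m) | m.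
               m \<in> polytope_lattice_points n \<nu>})"

end

theory Submission
  imports Defs "Jordan_Normal_Form.Determinant"
begin

text \<open>After conjugation, a split order contains all diagonal matrices with entries in the valuation
  ring. Multiplying by diagonal idempotents on both sides shows that it is then determined entrywise:
  it consists of the matrices whose \<open>(i, j)\<close> entry has valuation at least \<open>\<nu>\<^sub>i\<^sub>j\<close>, and being a ring
  forces \<open>\<nu>\<^sub>i\<^sub>i = 0\<close> and \<open>\<nu>\<^sub>i\<^sub>j \<le> \<nu>\<^sub>i\<^sub>k + \<nu>\<^sub>k\<^sub>j\<close>, which says exactly that \<open>C(\<nu>)\<close> is reduced. Each bound
  \<open>\<nu>\<^sub>i\<^sub>j\<close> is attained at a lattice point of \<open>C(\<nu>)\<close>, so the intersection over the polytope is this order.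
  Conversely, a maximal order containing it contains the same diagonal matrices, hence is the
  endomorphism ring of a lattice in the same apartment, given by a point of \<open>C(\<nu>)\<close>. The polytope is
  therefore recovered as the set of all maximal orders containing the split order, whichever apartment
  was chosen.\<close>

section \<open>Matrix rings\<close>

lemma matrix_ring_minus:
  assumes "A \<in> carrier_mat n n"
  shows "\<ominus>\<^bsub>matrix_ring n\<^esub> A = - (A :: 'k::field mat)"
proof -
  interpret ring "matrix_ring n :: 'k mat ring" by (rule ring_mat)
  show ?thesis
    by (rule minus_equality) (use assms in \<open>auto simp: ring_mat_simps\<close>)
qed

lemma subring_matrix_ring_iff:
  fixes S :: "'k::field mat set"
  shows "subring S (matrix_ring n) \<longleftrightarrow>
    S \<subseteq> carrier_mat n n \<and> 1\<^sub>m n \<in> S \<and> (\<forall>A\<in>S. - A \<in> S) \<and>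
    (\<forall>A\<in>S. \<forall>B\<in>S. A + B \<in> S) \<and> (\<forall>A\<in>S. \<forall>B\<in>S. A * B \<in> S)"
    (is "?l = ?r")
proof -
  interpret ring "matrix_ring n :: 'k mat ring" by (rule ring_mat)
  show ?thesis
  proof
    assume ?l
    then interpret subring S "matrix_ring n :: 'k mat ring" .
    have S: "S \<subseteq> carrier_mat n n" using subset by (simp add: ring_mat_simps)
    have "- A \<in> S" if "A \<in> S" for A
    proof -
      have "\<ominus>\<^bsub>matrix_ring n\<^esub> A \<in> S" using \<open>?l\<close> that by (rule subringE(5))
      then show ?thesis using matrix_ring_minus S that by (metis subsetD)
    qed
    then show ?r using S subringE(3,6,7)[OF \<open>?l\<close>] by (auto simp: ring_mat_simps)
  next
    assume ?r
    then show ?l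
      by (intro subringI) (auto simp: ring_mat_simps matrix_ring_minus subset_iff)
  qed
qed

text \<open>Turns the abstract sum of the ring into a matrix of entrywise sums, so that expansions
  in a basis can be computed entry by entry.\<close>

lemma finsum_matrix_ring:
  fixes F :: "'i \<Rightarrow> 'k::field mat"
  assumes "finite I" "\<And>l. l \<in> I \<Longrightarrow> F l \<in> carrier_mat n n"
  shows "finsum (matrix_ring n) F I = mat n n (\<lambda>ij. \<Sum>l\<in>I. F l $$ ij)"
proof -
  interpret ring "matrix_ring n :: 'k mat ring" by (rule ring_mat)
  show ?thesis using assms
  proof (induction I rule: finite_induct)
    case empty
    then show ?case by (auto simp: ring_mat_simps)
  next
    case (insert x I)
    have "finsum (matrix_ring n) F (insert x I) = F x \<oplus>\<^bsub>matrix_ring n\<^esub> finsum (matrix_ring n) F I"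
      using insert by (intro finsum_insert) (auto simp: ring_mat_simps)
    also have "\<dots> = mat n n (\<lambda>ij. \<Sum>l\<in>insert x I. F l $$ ij)"
      using insert by (auto simp: ring_mat_simps intro!: eq_matI)
    finally show ?case .
  qed
qed

text \<open>Naming the inverse explicitly keeps \<open>g\<close> and \<open>h\<close> symmetric:
  through \<open>inverse_pair_sym\<close>, each conjugation lemma also covers conjugating
  back.\<close>

definition inverse_pair :: "nat \<Rightarrow> 'k::field mat \<Rightarrow> 'k mat \<Rightarrow> bool" where
  "inverse_pair n g h \<longleftrightarrow> g \<in> carrier_mat n n \<and> h \<in> carrier_mat n n \<and> g * h = 1\<^sub>m n \<and> h * g = 1\<^sub>m n"

lemma inverse_pair_sym: "inverse_pair n g h \<Longrightarrow> inverse_pair n h g"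
  by (auto simp: inverse_pair_def)

lemma inverse_pair_Units:
  fixes g :: "'k::field mat"
  assumes "g \<in> Units (matrix_ring n)"
  shows "inverse_pair n g (inv\<^bsub>matrix_ring n\<^esub> g)"
proof -
  interpret ring "matrix_ring n :: 'k mat ring" by (rule ring_mat)
  show ?thesis
    using Units_inv_closed[OF assms] Units_closed[OF assms] Units_l_inv[OF assms] Units_r_inv[OF assms]
    by (simp add: inverse_pair_def ring_mat_simps)
qed

lemma square_mult_carrier:
  "A \<in> carrier_mat n n \<Longrightarrow> B \<in> carrier_mat n n \<Longrightarrow> A * B \<in> carrier_mat n n"
  by simp

lemmas assoc_square = assoc_mult_mat[of _ n n _ n _ n for n]

lemma conj_conj:
  fixes A :: "'k::field mat"
  assumes "inverse_pair n g h" "A \<in> carrier_mat n n"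
  shows "h * (g * A * h) * g = A"
proof -
  have c: "g \<in> carrier_mat n n" "h \<in> carrier_mat n n" using assms by (auto simp: inverse_pair_def)
  have "h * (g * A * h) * g = (h * g) * A * (h * g)"
    using c assms(2) by (simp add: assoc_square square_mult_carrier)
  then show ?thesis using assms by (simp add: inverse_pair_def)
qed

lemma conj_image_conj_image:
  fixes S :: "'k::field mat set"
  assumes "inverse_pair n g h" "S \<subseteq> carrier_mat n n"
  shows "(\<lambda>A. h * A * g) ` (\<lambda>A. g * A * h) ` S = S"
proof -
  have "(\<lambda>A. h * (g * A * h) * g) ` S = id ` S"
    using assms by (intro image_cong) (auto simp: conj_conj subset_iff)
  then show ?thesis by (simp add: image_image)
qed

lemma conj_inj_on:
  fixes g :: "'k::field mat"
  assumes "inverse_pair n g h"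
  shows "inj_on (\<lambda>A. g * A * h) (carrier_mat n n)"
  by (rule inj_on_inverseI[where g = "\<lambda>A. h * A * g"]) (simp add: conj_conj[OF assms])

lemma conj_mult:
  fixes A B :: "'k::field mat"
  assumes "inverse_pair n g h" "A \<in> carrier_mat n n" "B \<in> carrier_mat n n"
  shows "(g * A * h) * (g * B * h) = g * (A * B) * h"
proof -
  have c: "g \<in> carrier_mat n n" "h \<in> carrier_mat n n" using assms by (auto simp: inverse_pair_def)
  have "(g * A * h) * (g * B * h) = g * (A * (h * g) * B) * h"
    using c assms(2,3) by (simp add: assoc_square square_mult_carrier)
  then show ?thesis using assms by (simp add: inverse_pair_def)
qed

lemma conj_add:
  fixes A B :: "'k::field mat"
  assumes "inverse_pair n g h" "A \<in> carrier_mat n n" "B \<in> carrier_mat n n"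
  shows "g * A * h + g * B * h = g * (A + B) * h"
  using assms by (simp add: inverse_pair_def mult_add_distrib_mat[of _ n n _ n] add_mult_distrib_mat[of _ n n _ _ n] square_mult_carrier)

lemma conj_smult:
  fixes A :: "'k::field mat"
  assumes "inverse_pair n g h" "A \<in> carrier_mat n n"
  shows "c \<cdot>\<^sub>m (g * A * h) = g * (c \<cdot>\<^sub>m A) * h"
  using assms by (simp add: inverse_pair_def mult_smult_distrib[of _ n n _ n] mult_smult_assoc_mat[of _ n n _ n] square_mult_carrier)

lemma conj_uminus:
  fixes A :: "'k::field mat"
  assumes "inverse_pair n g h" "A \<in> carrier_mat n n"
  shows "- (g * A * h) = g * (- A) * h"
proof -
  have m: "- X = (-1) \<cdot>\<^sub>m X" if "X \<in> carrier_mat n n" for X :: "'k mat"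
    using that by (intro eq_matI) auto
  have c: "g * A * h \<in> carrier_mat n n" using assms by (auto simp: inverse_pair_def)
  show ?thesis using m[OF c] m[OF assms(2)] conj_smult[OF assms, of "-1"] by metis
qed

lemma conj_finsum:
  fixes F :: "'i \<Rightarrow> 'k::field mat"
  assumes "inverse_pair n g h" "finite I" "\<And>l. l \<in> I \<Longrightarrow> F l \<in> carrier_mat n n"
  shows "finsum (matrix_ring n) (\<lambda>l. g * F l * h) I = g * finsum (matrix_ring n) F I * h"
proof -
  interpret ring "matrix_ring n :: 'k mat ring" by (rule ring_mat)
  have c: "g \<in> carrier_mat n n" "h \<in> carrier_mat n n" using assms by (auto simp: inverse_pair_def)
  show ?thesis using assms(2,3)
  proof (induction I rule: finite_induct)
    case empty
    then show ?case using c by (simp add: ring_mat_simps)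
  next
    case (insert x I)
    have f: "finsum (matrix_ring n) F I \<in> carrier_mat n n"
      using insert by (subst finsum_matrix_ring) auto
    have "finsum (matrix_ring n) (\<lambda>l. g * F l * h) (insert x I) =
        g * F x * h + finsum (matrix_ring n) (\<lambda>l. g * F l * h) I"
      using insert c by (subst finsum_insert) (auto simp: ring_mat_simps)
    also have "\<dots> = g * (F x + finsum (matrix_ring n) F I) * h"
      using insert f by (simp add: conj_add[OF assms(1)])
    also have "F x + finsum (matrix_ring n) F I = finsum (matrix_ring n) F (insert x I)"
      using insert by (subst finsum_insert) (auto simp: ring_mat_simps)
    finally show ?case .
  qed
qed

section \<open>Orders\<close>

lemma is_order_subset: "is_order v n S \<Longrightarrow> S \<subseteq> carrier_mat n n"
  by (simp add: is_order_def subring_matrix_ring_iff)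

text \<open>Conjugation is a linear ring automorphism of the matrix ring, so it carries a basis
  \<open>B\<close> to the basis \<open>g * B l * h\<close> with the same coordinates. This reduces
  questions about an arbitrary apartment to the standard one.\<close>

lemma is_order_conj:
  fixes S :: "'k::field mat set"
  assumes gh: "inverse_pair n g h" and S: "is_order v n S"
  shows "is_order v n ((\<lambda>A. g * A * h) ` S)"
proof -
  note sub = is_order_subset[OF S]
  have c: "g \<in> carrier_mat n n" "h \<in> carrier_mat n n" using gh by (auto simp: inverse_pair_def)
  have r: "1\<^sub>m n \<in> S" "\<And>A. A \<in> S \<Longrightarrow> - A \<in> S" "\<And>A B. A \<in> S \<Longrightarrow> B \<in> S \<Longrightarrow> A + B \<in> S"
    "\<And>A B. A \<in> S \<Longrightarrow> B \<in> S \<Longrightarrow> A * B \<in> S"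
    using S by (auto simp: is_order_def subring_matrix_ring_iff)
  have one: "1\<^sub>m n = g * 1\<^sub>m n * h" using c gh by (metis inverse_pair_def right_mult_one_mat)
  have "subring ((\<lambda>A. g * A * h) ` S) (matrix_ring n)"
    unfolding subring_matrix_ring_iff
  proof (intro conjI ballI)
    show "(\<lambda>A. g * A * h) ` S \<subseteq> carrier_mat n n" using c sub by auto
    show "1\<^sub>m n \<in> (\<lambda>A. g * A * h) ` S" using r(1) one by blast
  next
    fix A assume "A \<in> (\<lambda>A. g * A * h) ` S"
    then show "- A \<in> (\<lambda>A. g * A * h) ` S" using r(2) sub conj_uminus[OF gh] by blast
  next
    fix A B assume "A \<in> (\<lambda>A. g * A * h) ` S" "B \<in> (\<lambda>A. g * A * h) ` S"
    then obtain A' B' where "A' \<in> S" "B' \<in> S" "A = g * A' * h" "B = g * B' * h" by blast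
    then show "A + B \<in> (\<lambda>A. g * A * h) ` S" "A * B \<in> (\<lambda>A. g * A * h) ` S"
      using r(3)[of A' B'] r(4)[of A' B'] sub conj_add[OF gh, of A' B'] conj_mult[OF gh, of A' B']
      by (auto simp: subset_iff)
  qed
  moreover have "free_of_rank v n (n\<^sup>2) ((\<lambda>A. g * A * h) ` S)"
  proof -
    obtain B where B: "B \<in> {..<n\<^sup>2} \<rightarrow> carrier_mat n n"
      and bij: "bij_betw (\<lambda>c. finsum (matrix_ring n) (\<lambda>l. c l \<cdot>\<^sub>m B l) {..<n\<^sup>2})
          ({..<n\<^sup>2} \<rightarrow>\<^sub>E valuation_ring v) S"
      using S by (auto simp: is_order_def free_of_rank_def)
    have "bij_betw (\<lambda>A. g * A * h) S ((\<lambda>A. g * A * h) ` S)"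
      using conj_inj_on[OF gh] sub by (meson bij_betw_imageI inj_on_subset)
    from bij_betw_trans[OF bij this]
    have "bij_betw (\<lambda>c. g * finsum (matrix_ring n) (\<lambda>l. c l \<cdot>\<^sub>m B l) {..<n\<^sup>2} * h)
          ({..<n\<^sup>2} \<rightarrow>\<^sub>E valuation_ring v) ((\<lambda>A. g * A * h) ` S)"
      by (simp add: comp_def)
    moreover have "g * finsum (matrix_ring n) (\<lambda>l. c l \<cdot>\<^sub>m B l) {..<n\<^sup>2} * h =
        finsum (matrix_ring n) (\<lambda>l. c l \<cdot>\<^sub>m (g * B l * h)) {..<n\<^sup>2}" for c
    proof -
      have "finsum (matrix_ring n) (\<lambda>l. c l \<cdot>\<^sub>m (g * B l * h)) {..<n\<^sup>2} =
          finsum (matrix_ring n) (\<lambda>l. g * (c l \<cdot>\<^sub>m B l) * h) {..<n\<^sup>2}"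
        using B c by (subst (1 2) finsum_matrix_ring)
          (auto simp: conj_smult[OF gh] Pi_def simp del: index_smult_mat intro!: eq_matI sum.cong)
      also have "\<dots> = g * finsum (matrix_ring n) (\<lambda>l. c l \<cdot>\<^sub>m B l) {..<n\<^sup>2} * h"
        using B by (intro conj_finsum[OF gh]) (auto simp: Pi_def)
      finally show ?thesis by simp
    qed
    ultimately have "bij_betw (\<lambda>c. finsum (matrix_ring n) (\<lambda>l. c l \<cdot>\<^sub>m (g * B l * h)) {..<n\<^sup>2})
          ({..<n\<^sup>2} \<rightarrow>\<^sub>E valuation_ring v) ((\<lambda>A. g * A * h) ` S)"
      by simp
    then show ?thesis unfolding free_of_rank_def
      using B c by (intro bexI[of _ "\<lambda>l. g * B l * h"]) auto
  qed
  ultimately show ?thesis by (simp add: is_order_def)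
qed

section \<open>Valuations\<close>

locale discrete_valuation =
  fixes v :: "'k::field \<Rightarrow> int" and \<pi> :: 'k
  assumes val_mult: "x \<noteq> 0 \<Longrightarrow> y \<noteq> 0 \<Longrightarrow> v (x * y) = v x + v y"
    and val_add: "x \<noteq> 0 \<Longrightarrow> y \<noteq> 0 \<Longrightarrow> x + y \<noteq> 0 \<Longrightarrow> min (v x) (v y) \<le> v (x + y)"
    and uniformizer: "uniformizer v \<pi>"
begin

lemma \<pi>_nonzero [simp]: "\<pi> \<noteq> 0" and val_\<pi>: "v \<pi> = 1"
  using uniformizer by (auto simp: uniformizer_def)

lemma val_one [simp]: "v 1 = 0"
  using val_mult[of 1 1] by simp

lemma val_minus_one: "v (-1) = 0"
  using val_mult[of "-1" "-1"] by simp

lemma val_minus: "x \<noteq> 0 \<Longrightarrow> v (- x) = v x"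
  using val_mult[of "-1" x] val_minus_one by simp

lemma val_inverse: "x \<noteq> 0 \<Longrightarrow> v (inverse x) = - v x"
  using val_mult[of x "inverse x"] by simp

lemma val_divide: "x \<noteq> 0 \<Longrightarrow> y \<noteq> 0 \<Longrightarrow> v (x / y) = v x - v y"
  by (simp add: divide_inverse val_mult val_inverse)

lemma val_power: "v (\<pi> ^ m) = int m"
  by (induction m) (auto simp: val_mult val_\<pi>)

lemma val_powi: "v (\<pi> powi m) = m"
  by (cases "m \<ge> 0") (auto simp: power_int_def val_power val_inverse power_inverse)

lemma zero_in_frac_ideal [simp]: "0 \<in> frac_ideal v N"
  by (simp add: frac_ideal_def)

lemma frac_ideal_mono: "x \<in> frac_ideal v M \<Longrightarrow> N \<le> M \<Longrightarrow> x \<in> frac_ideal v N"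
  by (auto simp: frac_ideal_def)

lemma frac_ideal_add:
  assumes "x \<in> frac_ideal v N" "y \<in> frac_ideal v N"
  shows "x + y \<in> frac_ideal v N"
proof (cases "x = 0 \<or> y = 0 \<or> x + y = 0")
  case False
  then have "min (v x) (v y) \<le> v (x + y)" by (intro val_add) auto
  then show ?thesis using assms False by (auto simp: frac_ideal_def)
qed (use assms in \<open>auto simp: frac_ideal_def\<close>)

lemma frac_ideal_minus: "x \<in> frac_ideal v N \<Longrightarrow> - x \<in> frac_ideal v N"
  using val_minus[of x] by (cases "x = 0") (auto simp: frac_ideal_def)

lemma frac_ideal_mult:
  "x \<in> frac_ideal v N \<Longrightarrow> y \<in> frac_ideal v M \<Longrightarrow> x * y \<in> frac_ideal v (N + M)"
  using val_mult[of x y] by (cases "x = 0"; cases "y = 0") (auto simp: frac_ideal_def)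

lemma frac_ideal_sum:
  "(\<And>i. i \<in> I \<Longrightarrow> f i \<in> frac_ideal v N) \<Longrightarrow> sum f I \<in> frac_ideal v N"
  by (induction I rule: infinite_finite_induct) (auto simp: frac_ideal_add)

lemma powi_in_frac_ideal: "\<pi> powi m \<in> frac_ideal v N \<longleftrightarrow> N \<le> m"
  by (simp add: frac_ideal_def val_powi)

lemma zero_one_in_valuation_ring [simp]: "0 \<in> valuation_ring v" "1 \<in> valuation_ring v"
  by (auto simp: valuation_ring_def frac_ideal_def)

lemma divide_powi_in_valuation_ring:
  "x / \<pi> powi m \<in> valuation_ring v \<longleftrightarrow> x \<in> frac_ideal v m"
  by (cases "x = 0") (auto simp: valuation_ring_def frac_ideal_def val_divide val_powi)

lemma finite_subset_frac_ideal:
  assumes "finite X"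
  shows "\<exists>N. X \<subseteq> frac_ideal v N"
proof (cases "X = {}")
  case False
  \<comment> \<open>If \<open>0\<close> lies in \<open>X\<close>, the minimum also ranges over the
    unconstrained value \<open>v 0\<close>. This can only lower it, and \<open>0\<close> belongs to
    every \<open>frac_ideal\<close> anyway.\<close>
  have "X \<subseteq> frac_ideal v (Min (v ` X))"
    using assms by (auto simp: frac_ideal_def)
  then show ?thesis by blast
qed auto

section \<open>Orders containing the diagonal matrices\<close>

lemma order_basis:
  assumes "is_order v n S"
  obtains B where "\<And>l. l < n\<^sup>2 \<Longrightarrow> B l \<in> S"
    "bij_betw (\<lambda>c. mat n n (\<lambda>ij. \<Sum>l<n\<^sup>2. c l * B l $$ ij)) ({..<n\<^sup>2} \<rightarrow>\<^sub>E valuation_ring v) S"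
proof -
  obtain B where B: "B \<in> {..<n\<^sup>2} \<rightarrow> carrier_mat n n"
    and bij: "bij_betw (\<lambda>c. finsum (matrix_ring n) (\<lambda>l. c l \<cdot>\<^sub>m B l) {..<n\<^sup>2})
        ({..<n\<^sup>2} \<rightarrow>\<^sub>E valuation_ring v) S"
    using assms by (auto simp: is_order_def free_of_rank_def)
  have "finsum (matrix_ring n) (\<lambda>l. c l \<cdot>\<^sub>m B l) {..<n\<^sup>2} =
      mat n n (\<lambda>ij. \<Sum>l<n\<^sup>2. c l * B l $$ ij)" for c
  proof -
    have "finsum (matrix_ring n) (\<lambda>l. c l \<cdot>\<^sub>m B l) {..<n\<^sup>2} =
      mat n n (\<lambda>ij. \<Sum>l<n\<^sup>2. (c l \<cdot>\<^sub>m B l) $$ ij)"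
      using B by (intro finsum_matrix_ring) (auto simp: Pi_def)
    also have "\<dots> = mat n n (\<lambda>ij. \<Sum>l<n\<^sup>2. c l * B l $$ ij)"
    proof -
      have "dim_row (B l) = n \<and> dim_col (B l) = n" if "l < n\<^sup>2" for l
        using B that by (auto simp: Pi_def)
      then show ?thesis by (intro eq_matI) (auto intro!: sum.cong)
    qed
    finally show ?thesis .
  qed
  then have bij': "bij_betw (\<lambda>c. mat n n (\<lambda>ij. \<Sum>l<n\<^sup>2. c l * B l $$ ij))
      ({..<n\<^sup>2} \<rightarrow>\<^sub>E valuation_ring v) S"
    using bij by simp
  have "B l \<in> S" if l: "l < n\<^sup>2" for l
  proof -
    \<comment> \<open>The freeness condition does not say outright that the basis lies in
      \<open>S\<close>; the unit coordinate tuple exhibits \<open>B l\<close> as a combination. The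
      restriction makes the tuple an element of the extensional function space.\<close>
    let ?c = "\<lambda>r\<in>{..<n\<^sup>2}. if r = l then 1 else 0"
    have "mat n n (\<lambda>ij. \<Sum>r<n\<^sup>2. ?c r * B r $$ ij) \<in> S"
      using bij_betw_apply[OF bij', of ?c] by auto
    also have "mat n n (\<lambda>ij. \<Sum>r<n\<^sup>2. ?c r * B r $$ ij) = B l"
    proof -
      have "(\<Sum>r<n\<^sup>2. ?c r * B r $$ ij) = (\<Sum>r<n\<^sup>2. if r = l then B r $$ ij else 0)" for ij
        by (intro sum.cong) auto
      then show ?thesis using l B by (intro eq_matI) (auto simp: Pi_def)
    qed
    finally show ?thesis .
  qed
  then show ?thesis using that bij' by blast
qed

text \<open>The finitely many entries of a basis have a common lower bound for their valuations, and
  combinations with integral coefficients respect it. This is what later makes least valuations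
  exist.\<close>

lemma order_bounded:
  assumes "is_order v n S"
  shows "\<exists>N. \<forall>A\<in>S. \<forall>i<n. \<forall>j<n. A $$ (i, j) \<in> frac_ideal v N"
proof -
  obtain B where bij: "bij_betw (\<lambda>c. mat n n (\<lambda>ij. \<Sum>l<n\<^sup>2. c l * B l $$ ij))
      ({..<n\<^sup>2} \<rightarrow>\<^sub>E valuation_ring v) S"
    by (rule order_basis[OF assms]) blast
  have "finite ((\<lambda>(l, ij). B l $$ ij) ` ({..<n\<^sup>2} \<times> ({..<n} \<times> {..<n})))" by simp
  then obtain N where N: "(\<lambda>(l, ij). B l $$ ij) ` ({..<n\<^sup>2} \<times> ({..<n} \<times> {..<n})) \<subseteq> frac_ideal v N"
    using finite_subset_frac_ideal by metis
  have "A $$ (i, j) \<in> frac_ideal v N" if A: "A \<in> S" and ij: "i < n" "j < n" for A i j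
  proof -
    obtain c where c: "c \<in> {..<n\<^sup>2} \<rightarrow>\<^sub>E valuation_ring v"
      and Ac: "A = mat n n (\<lambda>ij. \<Sum>l<n\<^sup>2. c l * B l $$ ij)"
      using A bij by (auto simp: bij_betw_def)
    have "c l * B l $$ (i, j) \<in> frac_ideal v (0 + N)" if "l < n\<^sup>2" for l
      using c N that ij by (intro frac_ideal_mult) (auto simp: valuation_ring_def PiE_iff subset_iff)
    then show ?thesis using ij Ac by (auto intro!: frac_ideal_sum)
  qed
  then show ?thesis by blast
qed

lemma index_less_square: "i < n \<Longrightarrow> j < n \<Longrightarrow> i * n + j < (n::nat)\<^sup>2"
proof -
  assume "i < n" "j < n"
  then have "i * n + j < Suc i * n" by simp
  also have "\<dots> \<le> n * n" using \<open>i < n\<close> by (intro mult_right_mono) auto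
  finally show ?thesis by (simp add: power2_eq_square)
qed

text \<open>If the \<open>(i, j)\<close> entry vanished on all of \<open>S\<close>, the square matrix of coordinates of a basis
  would have a zero row, and a vector in its kernel would clear to a relation over the valuation ring.\<close>

lemma order_entry_nonzero:
  assumes S: "is_order v n S" and ij: "i < n" "j < n"
  shows "\<exists>A\<in>S. A $$ (i, j) \<noteq> 0"
proof (rule ccontr)
  assume "\<not> ?thesis"
  then have zero: "A $$ (i, j) = 0" if "A \<in> S" for A using that by blast
  obtain B where B: "\<And>l. l < n\<^sup>2 \<Longrightarrow> B l \<in> S"
    and bij: "bij_betw (\<lambda>c. mat n n (\<lambda>ij. \<Sum>l<n\<^sup>2. c l * B l $$ ij))
      ({..<n\<^sup>2} \<rightarrow>\<^sub>E valuation_ring v) S"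
    by (rule order_basis[OF S]) blast
  \<comment> \<open>Column \<open>l\<close> of \<open>M\<close> lists the entries of
    \<open>B l\<close> row by row: position \<open>(p, q)\<close> has index
    \<open>p * n + q\<close>.\<close>
  define M where "M = mat (n\<^sup>2) (n\<^sup>2) (\<lambda>(r, l). B l $$ (r div n, r mod n))"
  have M: "M \<in> carrier_mat (n\<^sup>2) (n\<^sup>2)" by (simp add: M_def)
  have r: "i * n + j < n\<^sup>2" using ij by (rule index_less_square)
  have "det M = (\<Sum>l<n\<^sup>2. M $$ (i * n + j, l) * cofactor M (i * n + j) l)"
    using M r by (rule laplace_expansion_row)
  also have "\<dots> = 0"
    using r ij B by (intro sum.neutral) (auto simp: M_def zero)
  finally obtain w where w: "w \<in> carrier_vec (n\<^sup>2)" "w \<noteq> 0\<^sub>v (n\<^sup>2)" "M *\<^sub>v w = 0\<^sub>v (n\<^sup>2)"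
    using det_0_iff_vec_prod_zero_field[OF M] by auto
  \<comment> \<open>Dividing by \<open>\<pi> powi N\<close> makes all coordinates of
    \<open>w\<close> integral, so that uniqueness of coordinates over the valuation ring applies to
    \<open>c\<close>.\<close>
  obtain N where N: "($) w ` {..<n\<^sup>2} \<subseteq> frac_ideal v N"
    using finite_subset_frac_ideal[of "($) w ` {..<n\<^sup>2}"] by auto
  define c where "c = (\<lambda>l\<in>{..<n\<^sup>2}. w $ l / \<pi> powi N)"
  let ?z = "\<lambda>l\<in>{..<n\<^sup>2}. 0 :: 'k"
  have c_in: "c \<in> {..<n\<^sup>2} \<rightarrow>\<^sub>E valuation_ring v"
    using N by (auto simp: c_def divide_powi_in_valuation_ring)
  have "mat n n (\<lambda>ij. \<Sum>l<n\<^sup>2. c l * B l $$ ij) = mat n n (\<lambda>ij. \<Sum>l<n\<^sup>2. ?z l * B l $$ ij)"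
  proof (rule eq_matI; simp)
    fix p q assume pq: "p < n" "q < n"
    have "(M *\<^sub>v w) $ (p * n + q) = 0" using w(3) index_less_square[OF pq] by simp
    then have "(\<Sum>l<n\<^sup>2. B l $$ (p, q) * w $ l) = 0"
      using index_less_square[OF pq] pq w(1)
      by (simp add: M_def scalar_prod_def lessThan_atLeast0)
    then have "(\<Sum>l<n\<^sup>2. B l $$ (p, q) * w $ l) / \<pi> powi N = 0" by simp
    then show "(\<Sum>l<n\<^sup>2. c l * B l $$ (p, q)) = 0"
      by (simp add: c_def sum_divide_distrib mult.commute)
  qed
  moreover have "?z \<in> {..<n\<^sup>2} \<rightarrow>\<^sub>E valuation_ring v" by simp
  ultimately have "c = ?z"
    using inj_onD[OF bij_betw_imp_inj_on[OF bij], of c ?z] c_in by blast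
  then have "w $ l = 0" if "l < n\<^sup>2" for l
  proof -
    have "c l = 0" using \<open>c = ?z\<close> that by simp
    then show ?thesis using that by (simp add: c_def)
  qed
  then have "w = 0\<^sub>v (n\<^sup>2)" using w(1) by (intro eq_vecI) auto
  with w(2) show False by simp
qed

section \<open>Tiled orders and their exponent matrices\<close>

text \<open>For arbitrary exponents this is only a module over the valuation ring; it is a ring once
  \<open>exponent_matrix\<close> holds.\<close>

definition tiled_order :: "nat \<Rightarrow> (nat \<Rightarrow> nat \<Rightarrow> int) \<Rightarrow> 'k mat set" where
  "tiled_order n \<mu> = {A \<in> carrier_mat n n. \<forall>i<n. \<forall>j<n. A $$ (i, j) \<in> frac_ideal v (\<mu> i j)}"

end

text \<open>The condition is purely combinatorial and links the two sides of the correspondence: it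
  describes orders by \<open>order_containing_diagonal\<close> and reduced matrices by
  \<open>is_reduced_iff\<close>.\<close>

definition exponent_matrix :: "nat \<Rightarrow> (nat \<Rightarrow> nat \<Rightarrow> int) \<Rightarrow> bool" where
  "exponent_matrix n \<mu> \<longleftrightarrow>
     (\<forall>i<n. \<mu> i i = 0) \<and> (\<forall>i<n. \<forall>j<n. \<forall>k<n. \<mu> i j \<le> \<mu> i k + \<mu> k j)"

context discrete_valuation
begin

lemma mat_diag_in_diagonal_ring:
  "(\<And>i. i < n \<Longrightarrow> d i \<in> valuation_ring v) \<Longrightarrow> mat_diag n d \<in> diagonal_ring v n"
  by (auto simp: diagonal_ring_def)

lemma diagonal_subset_tiled_order:
  assumes "exponent_matrix n \<mu>"
  shows "diagonal_ring v n \<subseteq> tiled_order n \<mu>"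
  using assms by (auto simp: diagonal_ring_def tiled_order_def mat_diag_def exponent_matrix_def valuation_ring_def)

text \<open>The matrix units scaled by \<open>\<pi> powi \<mu> i j\<close> form a basis, numbered by
  \<open>i * n + j\<close>.\<close>

lemma tiled_order_free: "free_of_rank v n (n\<^sup>2) (tiled_order n \<mu>)"
proof -
  define B :: "nat \<Rightarrow> 'k mat" where
    "B l = mat n n (\<lambda>(i, j). if l = i * n + j then \<pi> powi \<mu> i j else 0)" for l
  have dm: "l div n < n" "l mod n < n" if "l < n\<^sup>2" for l
    using that by (auto simp: power2_eq_square less_mult_imp_div_less) (metis mod_less_divisor mult_0 not_less_zero neq0_conv)
  define F where "F c = mat n n (\<lambda>(i, j). c (i * n + j) * \<pi> powi \<mu> i j)" for c :: "nat \<Rightarrow> 'k"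
  have F: "finsum (matrix_ring n) (\<lambda>l. c l \<cdot>\<^sub>m B l) {..<n\<^sup>2} = F c" for c
  proof -
    have "finsum (matrix_ring n) (\<lambda>l. c l \<cdot>\<^sub>m B l) {..<n\<^sup>2} =
      mat n n (\<lambda>ij. \<Sum>l<n\<^sup>2. (c l \<cdot>\<^sub>m B l) $$ ij)"
      by (intro finsum_matrix_ring) (auto simp: B_def)
    also have "\<dots> = F c"
    proof (rule eq_matI; simp add: F_def)
      fix i j assume ij: "i < n" "j < n"
      have "(\<Sum>l<n\<^sup>2. (c l \<cdot>\<^sub>m B l) $$ (i, j)) =
          (\<Sum>l<n\<^sup>2. if l = i * n + j then c l * \<pi> powi \<mu> i j else 0)"
        using ij by (intro sum.cong) (auto simp: B_def)
      then show "(\<Sum>l<n\<^sup>2. (c l \<cdot>\<^sub>m B l) $$ (i, j)) = c (i * n + j) * \<pi> powi \<mu> i j"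
        using index_less_square[OF ij] by simp
    qed
    finally show ?thesis .
  qed
  \<comment> \<open>Coordinates are recovered by dividing each entry by its power of
    \<open>\<pi>\<close>. The restriction to indices below \<open>n\<^sup>2\<close> is what makes
    \<open>G\<close> an exact inverse of \<open>F\<close> on extensional tuples.\<close>
  define G where "G A = (\<lambda>l\<in>{..<n\<^sup>2}. A $$ (l div n, l mod n) / \<pi> powi \<mu> (l div n) (l mod n))"
    for A :: "'k mat"
  have "bij_betw F ({..<n\<^sup>2} \<rightarrow>\<^sub>E valuation_ring v) (tiled_order n \<mu>)"
  proof (rule bij_betw_byWitness[where f' = G])
    show "\<forall>c\<in>{..<n\<^sup>2} \<rightarrow>\<^sub>E valuation_ring v. G (F c) = c"
      by (auto simp: G_def F_def dm fun_eq_iff PiE_iff extensional_def)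
    show "\<forall>A\<in>tiled_order n \<mu>. F (G A) = A"
      by (auto simp: G_def F_def tiled_order_def index_less_square intro!: eq_matI)
    show "F ` ({..<n\<^sup>2} \<rightarrow>\<^sub>E valuation_ring v) \<subseteq> tiled_order n \<mu>"
    proof (rule image_subsetI)
      fix c assume c: "c \<in> {..<n\<^sup>2} \<rightarrow>\<^sub>E valuation_ring v"
      have "c (i * n + j) * \<pi> powi \<mu> i j \<in> frac_ideal v (0 + \<mu> i j)" if "i < n" "j < n" for i j
        using c that index_less_square[OF that]
        by (intro frac_ideal_mult) (auto simp: powi_in_frac_ideal PiE_iff valuation_ring_def)
      then show "F c \<in> tiled_order n \<mu>" by (simp add: F_def tiled_order_def)
    qed
    show "G ` tiled_order n \<mu> \<subseteq> {..<n\<^sup>2} \<rightarrow>\<^sub>E valuation_ring v"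
    proof (rule image_subsetI)
      fix A assume "A \<in> tiled_order n \<mu>"
      then show "G A \<in> {..<n\<^sup>2} \<rightarrow>\<^sub>E valuation_ring v"
        unfolding G_def by (intro restrict_PiE_iff[THEN iffD2] ballI)
          (auto simp: tiled_order_def divide_powi_in_valuation_ring dm)
    qed
  qed
  then show ?thesis unfolding free_of_rank_def
    by (intro bexI[of _ B]) (simp_all only: F, simp add: B_def)
qed

text \<open>The triangle inequality gives closure under products, and the zero diagonal puts the
  identity inside.\<close>

lemma tiled_order_is_order:
  assumes \<mu>: "exponent_matrix n \<mu>"
  shows "is_order v n (tiled_order n \<mu>)"
proof -
  have "A * B \<in> tiled_order n \<mu>" if A: "A \<in> tiled_order n \<mu>" and B: "B \<in> tiled_order n \<mu>" for A B
  proof -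
    have "A $$ (i, k) * B $$ (k, j) \<in> frac_ideal v (\<mu> i j)" if "i < n" "j < n" "k < n" for i j k
    proof (rule frac_ideal_mono)
      show "A $$ (i, k) * B $$ (k, j) \<in> frac_ideal v (\<mu> i k + \<mu> k j)"
        using A B that by (intro frac_ideal_mult) (auto simp: tiled_order_def)
      show "\<mu> i j \<le> \<mu> i k + \<mu> k j" using \<mu> that by (auto simp: exponent_matrix_def)
    qed
    then show ?thesis
      using A B by (auto simp: tiled_order_def scalar_prod_def intro!: frac_ideal_sum)
  qed
  moreover have "1\<^sub>m n \<in> tiled_order n \<mu>"
    using diagonal_subset_tiled_order[OF \<mu>] mat_diag_in_diagonal_ring[of n "\<lambda>_. 1"] by auto
  ultimately have "subring (tiled_order n \<mu>) (matrix_ring n)"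
    by (auto simp: subring_matrix_ring_iff) (auto simp: tiled_order_def frac_ideal_minus frac_ideal_add)
  then show ?thesis by (simp add: is_order_def tiled_order_free)
qed

text \<open>Multiplying \<open>A\<close> by diagonal idempotents on both sides isolates its
  \<open>(i, j)\<close> entry, and an integral factor on the left rescales that entry to
  \<open>x\<close>.\<close>

lemma order_matrix_unit:
  assumes S: "is_order v n S" and diag: "diagonal_ring v n \<subseteq> S"
    and A: "A \<in> S" and ij: "i < n" "j < n" and x: "x = 0 \<or> A $$ (i, j) \<noteq> 0 \<and> v (A $$ (i, j)) \<le> v x"
  shows "mat n n (\<lambda>(p, q). if p = i \<and> q = j then x else 0) \<in> S"
proof -
  have sub: "S \<subseteq> carrier_mat n n" using S by (rule is_order_subset)
  have mult: "\<And>A B. A \<in> S \<Longrightarrow> B \<in> S \<Longrightarrow> A * B \<in> S"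
    using S by (auto simp: is_order_def subring_matrix_ring_iff)
  \<comment> \<open>If \<open>x = 0\<close>, this quotient is \<open>0\<close> even when the entry
    of \<open>A\<close> vanishes, so both cases of the assumption are covered.\<close>
  let ?c = "x / A $$ (i, j)"
  have c: "?c \<in> valuation_ring v"
    using x by (cases "x = 0") (auto simp: valuation_ring_def frac_ideal_def val_divide)
  let ?L = "mat_diag n (\<lambda>p. if p = i then ?c else 0)"
  let ?R = "mat_diag n (\<lambda>q. if q = j then 1 else 0)"
  have "?L \<in> S" "?R \<in> S"
    using c by (auto intro!: subsetD[OF diag] mat_diag_in_diagonal_ring)
  then have "?L * A * ?R \<in> S" using A mult by blast
  moreover have "?L * A * ?R = mat n n (\<lambda>(p, q). if p = i \<and> q = j then x else 0)"
  proof -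
    have An: "A \<in> carrier_mat n n" using A sub by blast
    have "?L * A * ?R = mat n n (\<lambda>(p, q). (?L * A) $$ (p, q) * (if q = j then 1 else 0))"
      by (rule mat_diag_mult_right) (use An in \<open>auto intro: square_mult_carrier\<close>)
    then show ?thesis
      using x An by (auto simp: mat_diag_mult_left[OF An] intro!: eq_matI)
  qed
  ultimately show ?thesis by simp
qed

text \<open>By \<open>order_bounded\<close> and \<open>order_entry_nonzero\<close>, the nonzero
  \<open>(i, j)\<close> entries of members of \<open>S\<close> have a least valuation, which becomes
  \<open>\<mu> i j\<close>. By \<open>order_matrix_unit\<close>, any entry of at least that
  valuation can be placed alone in a member of \<open>S\<close>, and every tiled matrix is a sum of
  such members.\<close>

theorem order_containing_diagonal:
  assumes S: "is_order v n S" and diag: "diagonal_ring v n \<subseteq> S"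
  shows "\<exists>\<mu>. exponent_matrix n \<mu> \<and> S = tiled_order n \<mu>"
proof -
  have sub: "S \<subseteq> carrier_mat n n" using S by (rule is_order_subset)
  have r: "1\<^sub>m n \<in> S" "\<And>A B. A \<in> S \<Longrightarrow> B \<in> S \<Longrightarrow> A + B \<in> S"
    "\<And>A B. A \<in> S \<Longrightarrow> B \<in> S \<Longrightarrow> A * B \<in> S"
    using S by (auto simp: is_order_def subring_matrix_ring_iff)
  obtain N where N: "\<And>A i j. A \<in> S \<Longrightarrow> i < n \<Longrightarrow> j < n \<Longrightarrow> A $$ (i, j) \<in> frac_ideal v N"
    using order_bounded[OF S] by blast
  have min_ex: "\<exists>A. A \<in> S \<and> A $$ (i, j) \<noteq> 0 \<and>
      (\<forall>B\<in>S. B $$ (i, j) \<in> frac_ideal v (v (A $$ (i, j))))"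
    if ij: "i < n" "j < n" for i j
  proof -
    let ?P = "\<lambda>A. A \<in> S \<and> A $$ (i, j) \<noteq> 0"
    \<comment> \<open>Shifting by the lower bound \<open>N\<close> loses nothing in
      \<open>nat\<close>, so minimality over the natural numbers is minimality of the
      valuation.\<close>
    let ?m = "\<lambda>A. nat (v (A $$ (i, j)) - N)"
    obtain A where A: "?P A" "\<And>B. ?P B \<Longrightarrow> ?m A \<le> ?m B"
      using order_entry_nonzero[OF S ij] ex_has_least_nat[of ?P _ ?m] by blast
    have ge: "N \<le> v (B $$ (i, j))" if "?P B" for B
      using N[of B i j] that ij by (auto simp: frac_ideal_def)
    have "v (A $$ (i, j)) \<le> v (B $$ (i, j))" if "?P B" for B
      using A(2)[OF that] ge[OF that] ge[OF A(1)] by linarith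
    then show ?thesis using A(1) by (auto simp: frac_ideal_def)
  qed
  define W where "W i j = (SOME A. A \<in> S \<and> A $$ (i, j) \<noteq> 0 \<and>
      (\<forall>B\<in>S. B $$ (i, j) \<in> frac_ideal v (v (A $$ (i, j)))))" for i j
  define \<mu> where "\<mu> i j = v (W i j $$ (i, j))" for i j
  have W: "W i j \<in> S" "W i j $$ (i, j) \<noteq> 0" "B \<in> S \<Longrightarrow> B $$ (i, j) \<in> frac_ideal v (\<mu> i j)"
    if "i < n" "j < n" for i j B
    using someI_ex[OF min_ex[OF that]] by (auto simp: W_def \<mu>_def)
  define E :: "nat \<Rightarrow> nat \<Rightarrow> 'k \<Rightarrow> 'k mat" where
    "E i j x = mat n n (\<lambda>(p, q). if p = i \<and> q = j then x else 0)" for i j x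
  have E: "E i j x \<in> S" if "i < n" "j < n" "x \<in> frac_ideal v (\<mu> i j)" for i j x
    unfolding E_def using W(1,2)[OF that(1,2)] that
    by (intro order_matrix_unit[OF S diag]) (auto simp: frac_ideal_def \<mu>_def)
  have tri: "\<mu> i j \<le> \<mu> i k + \<mu> k j" if ijk: "i < n" "j < n" "k < n" for i j k
  proof -
    \<comment> \<open>The \<open>(i, j)\<close> entry of this product has valuation exactly
      \<open>\<mu> i k + \<mu> k j\<close>, which cannot lie below the minimum
      \<open>\<mu> i j\<close>.\<close>
    have "E i k (\<pi> powi \<mu> i k) * E k j (\<pi> powi \<mu> k j) \<in> S"
      using ijk by (intro r(3) E) (auto simp: powi_in_frac_ideal)
    then have "(E i k (\<pi> powi \<mu> i k) * E k j (\<pi> powi \<mu> k j)) $$ (i, j) \<in> frac_ideal v (\<mu> i j)"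
      using W(3) ijk by blast
    also have "(E i k (\<pi> powi \<mu> i k) * E k j (\<pi> powi \<mu> k j)) $$ (i, j) =
        (\<Sum>l<n. (if l = k then \<pi> powi \<mu> i k else 0) * (if l = k then \<pi> powi \<mu> k j else 0))"
      using ijk by (simp add: E_def scalar_prod_def lessThan_atLeast0)
    also have "\<dots> = (\<Sum>l<n. if l = k then \<pi> powi \<mu> i k * \<pi> powi \<mu> k j else 0)"
      by (intro sum.cong) auto
    also have "\<dots> = \<pi> powi (\<mu> i k + \<mu> k j)" using ijk by (simp add: power_int_add)
    finally show ?thesis by (simp add: powi_in_frac_ideal)
  qed
  \<comment> \<open>The identity lies in \<open>S\<close>, so \<open>\<mu> i i\<close> is at most
    \<open>0\<close>; the triangle inequality with all three indices equal to \<open>i\<close> gives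
    the other bound.\<close>
  have diag0: "\<mu> i i = 0" if "i < n" for i
    using W(3)[OF that that r(1)] tri[OF that that that] that by (simp add: frac_ideal_def)
  have "tiled_order n \<mu> \<subseteq> S"
  proof
    fix A assume A: "A \<in> tiled_order n \<mu>"
    \<comment> \<open>\<open>?T X\<close> keeps the entries of \<open>A\<close> at the positions in
      \<open>X\<close>. Adding one position adds one scaled matrix unit from \<open>S\<close>, and
      the full index set gives back \<open>A\<close>.\<close>
    let ?T = "\<lambda>X. mat n n (\<lambda>ij. if ij \<in> X then A $$ ij else 0)"
    have "mat_diag n (\<lambda>_. 0 :: 'k) = 0\<^sub>m n n" by (auto simp: mat_diag_def)
    then have zero: "0\<^sub>m n n \<in> S"
      using subsetD[OF diag mat_diag_in_diagonal_ring[of n "\<lambda>_. 0"]] by auto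
    have "?T X \<in> S" if "finite X" "X \<subseteq> {..<n} \<times> {..<n}" for X
      using that
    proof (induction X rule: finite_induct)
      case empty
      have "?T {} = 0\<^sub>m n n" by auto
      then show ?case using zero by simp
    next
      case (insert x X)
      obtain i j where x: "x = (i, j)" by force
      have ij: "i < n" "j < n" using insert x by auto
      have "E i j (A $$ (i, j)) + ?T X \<in> S"
        using A ij insert by (intro r(2) E) (auto simp: tiled_order_def)
      moreover have "E i j (A $$ (i, j)) + ?T X = ?T (insert x X)"
        using insert(2) by (intro eq_matI) (auto simp: E_def x)
      ultimately show ?case by simp
    qed
    from this[of "{..<n} \<times> {..<n}"] have "?T ({..<n} \<times> {..<n}) \<in> S" by simp
    moreover have "?T ({..<n} \<times> {..<n}) = A"
      using A by (intro eq_matI) (auto simp: tiled_order_def)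
    ultimately show "A \<in> S" by simp
  qed
  moreover have "S \<subseteq> tiled_order n \<mu>"
    using W(3) sub by (auto simp: tiled_order_def)
  ultimately show ?thesis using tri diag0 by (auto simp: exponent_matrix_def)
qed

end

section \<open>Polytopes and reduced matrices\<close>

text \<open>The lower bounds in \<open>polytope\<close> are the upper bounds with the indices
  exchanged, so one family of integer inequalities remains.\<close>

lemma polytope_lattice_points_iff:
  "m \<in> polytope_lattice_points n \<nu> \<longleftrightarrow>
     m \<in> carrier_vec n \<and> m $ 0 = 0 \<and> (\<forall>i<n. \<forall>j<n. m $ i - m $ j \<le> \<nu> $$ (i, j))"
  if "1 \<le> n"
proof -
  have eq: "((- of_int (\<nu> $$ (j, i)) :: real) \<le> map_vec of_int m $ i - map_vec of_int m $ j \<and>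
      map_vec of_int m $ i - map_vec of_int m $ j \<le> (of_int (\<nu> $$ (i, j)) :: real)) \<longleftrightarrow>
      m $ j - m $ i \<le> \<nu> $$ (j, i) \<and> m $ i - m $ j \<le> \<nu> $$ (i, j)"
    if "m \<in> carrier_vec n" "i < n" "j < n" for i j
    unfolding of_int_le_iff[where 'a = real, symmetric] using that by auto
  show ?thesis
    using that eq by (auto simp: polytope_lattice_points_def lattice_points_def polytope_def)
qed

text \<open>The columns of an exponent matrix, shifted to have first coordinate \<open>0\<close>, are lattice points of
  its polytope, and the \<open>j\<close>-th of them lies on the hyperplanes \<open>x\<^sub>i - x\<^sub>j = \<nu>\<^sub>i\<^sub>j\<close> for all \<open>i\<close>.\<close>

lemma exponent_matrix_vertex:
  assumes "1 \<le> n" "exponent_matrix n (\<lambda>i j. \<nu> $$ (i, j))" "j < n"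
  shows "\<exists>m\<in>polytope_lattice_points n \<nu>. \<forall>i<n. m $ i - m $ j = \<nu> $$ (i, j)"
proof (intro bexI)
  let ?m = "vec n (\<lambda>i. \<nu> $$ (i, j) - \<nu> $$ (0, j))"
  show "?m \<in> polytope_lattice_points n \<nu>"
    using assms by (auto simp: polytope_lattice_points_iff exponent_matrix_def algebra_simps)
  show "\<forall>i<n. ?m $ i - ?m $ j = \<nu> $$ (i, j)"
    using assms by (auto simp: exponent_matrix_def)
qed

text \<open>A point with \<open>x $ i - x $ j\<close> equal to its bound, split through
  \<open>x $ k\<close>, yields the triangle inequality, and the case \<open>i = j\<close> yields the
  zero diagonal. Conversely, the points of \<open>exponent_matrix_vertex\<close> attain all
  bounds.\<close>

lemma is_reduced_iff:
  assumes n: "1 \<le> n"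
  shows "is_reduced n \<nu> \<longleftrightarrow> exponent_matrix n (\<lambda>i j. \<nu> $$ (i, j))"
proof
  assume red: "is_reduced n \<nu>"
  have pt: "\<exists>x\<in>polytope n \<nu>. x $ i - x $ j = of_int (\<nu> $$ (i, j))" if "i < n" "j < n" for i j
    using red that unfolding is_reduced_def by blast
  have "\<nu> $$ (i, j) \<le> \<nu> $$ (i, k) + \<nu> $$ (k, j)" if ijk: "i < n" "j < n" "k < n" for i j k
  proof -
    obtain x where x: "x \<in> polytope n \<nu>" "x $ i - x $ j = of_int (\<nu> $$ (i, j))"
      using pt ijk by blast
    have "x $ i - x $ k \<le> of_int (\<nu> $$ (i, k))" "x $ k - x $ j \<le> of_int (\<nu> $$ (k, j))"
      using x ijk by (auto simp: polytope_def)
    then have "real_of_int (\<nu> $$ (i, j)) \<le> of_int (\<nu> $$ (i, k) + \<nu> $$ (k, j))"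
      using x(2) by simp
    then show ?thesis by (simp only: of_int_le_iff)
  qed
  moreover have "\<nu> $$ (i, i) = 0" if "i < n" for i
    using pt[OF that that] by auto
  ultimately show "exponent_matrix n (\<lambda>i j. \<nu> $$ (i, j))" by (simp add: exponent_matrix_def)
next
  assume ex: "exponent_matrix n (\<lambda>i j. \<nu> $$ (i, j))"
  note vertex = exponent_matrix_vertex[OF n ex]
  have "polytope n \<nu> \<inter> {x. x $ i - x $ j = of_int (\<nu> $$ (i, j))} \<noteq> {}" if ij: "i < n" "j < n" for i j
  proof -
    obtain m where m: "m \<in> polytope_lattice_points n \<nu>" "m $ i - m $ j = \<nu> $$ (i, j)"
      using vertex[OF ij(2)] ij by blast
    then have "m \<in> carrier_vec n" by (simp add: polytope_lattice_points_def lattice_points_def)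
    then have "map_vec of_int m $ i - map_vec of_int m $ j = (of_int (\<nu> $$ (i, j)) :: real)"
      using ij m(2) by (simp flip: of_int_diff)
    moreover have "map_vec of_int m \<in> polytope n \<nu>"
      using m(1) by (simp add: polytope_lattice_points_def)
    ultimately show ?thesis by blast
  qed
  moreover have "polytope_lattice_points n \<nu> \<noteq> {}" using vertex[of 0] n by auto
  ultimately show "is_reduced n \<nu>" by (simp add: is_reduced_def)
qed

section \<open>Endomorphism rings of lattices\<close>

text \<open>Transport of structure along \<open>g\<close>: a matrix preserves the image lattice
  exactly when its conjugate by \<open>h\<close> preserves \<open>L\<close>.\<close>

lemma lattice_End_conj:
  fixes g :: "'k::field mat"
  assumes gh: "inverse_pair n g h" and L: "L \<subseteq> carrier_vec n"
  shows "lattice_End n ((*\<^sub>v) g ` L) = (\<lambda>A. g * A * h) ` lattice_End n L"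
proof -
  have c: "g \<in> carrier_mat n n" "h \<in> carrier_mat n n" "g * h = 1\<^sub>m n" "h * g = 1\<^sub>m n"
    using gh by (auto simp: inverse_pair_def)
  have cancel: "h *\<^sub>v (g *\<^sub>v x) = x" if "x \<in> carrier_vec n" for x
    using c that by (simp flip: assoc_mult_mat_vec)
  have act: "(X * A * Y) *\<^sub>v x = X *\<^sub>v (A *\<^sub>v (Y *\<^sub>v x))"
    if "X \<in> carrier_mat n n" "A \<in> carrier_mat n n" "Y \<in> carrier_mat n n" "x \<in> carrier_vec n"
    for X A Y :: "'k mat" and x
    using that by (simp add: assoc_mult_mat_vec[of _ n n _ n] square_mult_carrier)
  show ?thesis
  proof (intro equalityI subsetI)
    fix A assume A: "A \<in> lattice_End n ((*\<^sub>v) g ` L)"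
    then have Ac: "A \<in> carrier_mat n n" by (simp add: lattice_End_def)
    have "(h * A * g) *\<^sub>v x \<in> L" if x: "x \<in> L" for x
    proof -
      have "A *\<^sub>v (g *\<^sub>v x) \<in> (*\<^sub>v) g ` L" using A x by (auto simp: lattice_End_def)
      then obtain y where y: "y \<in> L" "A *\<^sub>v (g *\<^sub>v x) = g *\<^sub>v y" by blast
      then have "(h * A * g) *\<^sub>v x = y"
        using act[OF c(2) Ac c(1)] x L cancel by (auto simp: subset_iff)
      with y show ?thesis by simp
    qed
    then have "h * A * g \<in> lattice_End n L"
      using c Ac by (auto simp: lattice_End_def)
    moreover have "A = g * (h * A * g) * h"
      using conj_conj[OF inverse_pair_sym[OF gh] Ac] by simp
    ultimately show "A \<in> (\<lambda>A. g * A * h) ` lattice_End n L" by blast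
  next
    fix A assume "A \<in> (\<lambda>A. g * A * h) ` lattice_End n L"
    then obtain B where B: "B \<in> carrier_mat n n" "\<And>x. x \<in> L \<Longrightarrow> B *\<^sub>v x \<in> L" "A = g * B * h"
      by (auto simp: lattice_End_def)
    have "A *\<^sub>v (g *\<^sub>v x) = g *\<^sub>v (B *\<^sub>v x)" if "x \<in> L" for x
    proof -
      have "x \<in> carrier_vec n" using that L by blast
      then show ?thesis using act[OF c(1) B(1) c(2), of "g *\<^sub>v x"] c B(3) cancel by simp
    qed
    then show "A \<in> lattice_End n ((*\<^sub>v) g ` L)"
      using B c by (auto simp: lattice_End_def)
  qed
qed

context discrete_valuation
begin

lemma coordinate_lattice_eq:
  "coordinate_lattice v \<pi> n m = {x \<in> carrier_vec n. \<forall>i<n. x $ i \<in> frac_ideal v (m $ i)}"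
proof (intro equalityI subsetI)
  fix x assume "x \<in> coordinate_lattice v \<pi> n m"
  then obtain a where x: "x = vec n (\<lambda>i. a i * \<pi> powi (m $ i))" and a: "\<forall>i<n. a i \<in> valuation_ring v"
    by (auto simp: coordinate_lattice_def)
  have "a i * \<pi> powi (m $ i) \<in> frac_ideal v (0 + m $ i)" if "i < n" for i
    using a that by (intro frac_ideal_mult) (auto simp: valuation_ring_def powi_in_frac_ideal)
  then show "x \<in> {x \<in> carrier_vec n. \<forall>i<n. x $ i \<in> frac_ideal v (m $ i)}" by (simp add: x)
next
  fix x assume x: "x \<in> {x \<in> carrier_vec n. \<forall>i<n. x $ i \<in> frac_ideal v (m $ i)}"
  then have "x = vec n (\<lambda>i. (x $ i / \<pi> powi (m $ i)) * \<pi> powi (m $ i))"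
    by (intro eq_vecI) auto
  then show "x \<in> coordinate_lattice v \<pi> n m"
    unfolding coordinate_lattice_def using x
    by (intro CollectI exI[of _ "\<lambda>i. x $ i / \<pi> powi (m $ i)"])
      (auto simp: divide_powi_in_valuation_ring)
qed

text \<open>Applying \<open>A\<close> to \<open>\<pi> powi (m $ j)\<close> times the
  \<open>j\<close>-th basis vector reads off the condition on column \<open>j\<close>; conversely,
  these bounds add up correctly in each product \<open>A $$ (i, j) * x $ j\<close>.\<close>

lemma lattice_End_coordinate_lattice:
  "lattice_End n (coordinate_lattice v \<pi> n m) = tiled_order n (\<lambda>i j. m $ i - m $ j)"
proof (intro equalityI subsetI)
  fix A assume A: "A \<in> lattice_End n (coordinate_lattice v \<pi> n m)"
  then have Ac: "A \<in> carrier_mat n n" by (simp add: lattice_End_def)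
  have "A $$ (i, j) \<in> frac_ideal v (m $ i - m $ j)" if ij: "i < n" "j < n" for i j
  proof -
    let ?x = "vec n (\<lambda>l. if l = j then \<pi> powi (m $ j) else 0)"
    have "?x \<in> coordinate_lattice v \<pi> n m"
      by (auto simp: coordinate_lattice_eq powi_in_frac_ideal)
    then have "A *\<^sub>v ?x \<in> coordinate_lattice v \<pi> n m"
      using A by (auto simp: lattice_End_def)
    then have "(A *\<^sub>v ?x) $ i \<in> frac_ideal v (m $ i)"
      using ij by (simp add: coordinate_lattice_eq)
    moreover have "(A *\<^sub>v ?x) $ i = (\<Sum>l<n. A $$ (i, l) * (if l = j then \<pi> powi (m $ j) else 0))"
      using Ac ij by (simp add: scalar_prod_def lessThan_atLeast0)
    moreover have "\<dots> = (\<Sum>l<n. if l = j then A $$ (i, l) * \<pi> powi (m $ j) else 0)"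
      by (intro sum.cong) auto
    moreover have "\<dots> = A $$ (i, j) * \<pi> powi (m $ j)"
      using ij by simp
    ultimately have "A $$ (i, j) * \<pi> powi (m $ j) \<in> frac_ideal v (m $ i)" by simp
    then have "A $$ (i, j) * \<pi> powi (m $ j) * \<pi> powi (- (m $ j)) \<in> frac_ideal v (m $ i + - (m $ j))"
      by (rule frac_ideal_mult) (simp add: powi_in_frac_ideal)
    then show ?thesis by (simp add: power_int_minus mult.assoc)
  qed
  then show "A \<in> tiled_order n (\<lambda>i j. m $ i - m $ j)" using Ac by (simp add: tiled_order_def)
next
  fix A assume A: "A \<in> tiled_order n (\<lambda>i j. m $ i - m $ j)"
  then have Ac: "A \<in> carrier_mat n n" by (simp add: tiled_order_def)
  have "A *\<^sub>v x \<in> coordinate_lattice v \<pi> n m" if x: "x \<in> coordinate_lattice v \<pi> n m" for x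
  proof -
    have "A $$ (i, j) * x $ j \<in> frac_ideal v ((m $ i - m $ j) + m $ j)" if "i < n" "j < n" for i j
      using A x that by (intro frac_ideal_mult) (auto simp: tiled_order_def coordinate_lattice_eq)
    then show ?thesis
      using Ac x by (auto simp: coordinate_lattice_eq scalar_prod_def intro!: frac_ideal_sum)
  qed
  then show "A \<in> lattice_End n (coordinate_lattice v \<pi> n m)" using Ac by (simp add: lattice_End_def)
qed

text \<open>A single test matrix decides inclusion: the one whose entries are
  \<open>\<pi> powi \<mu> i j\<close> attains every bound at once.\<close>

lemma tiled_order_subset_iff:
  "tiled_order n \<mu> \<subseteq> tiled_order n \<mu>' \<longleftrightarrow> (\<forall>i<n. \<forall>j<n. \<mu>' i j \<le> \<mu> i j)"
proof
  assume sub: "tiled_order n \<mu> \<subseteq> tiled_order n \<mu>'"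
  have "mat n n (\<lambda>(i, j). \<pi> powi \<mu> i j) \<in> tiled_order n \<mu>"
    by (simp add: tiled_order_def powi_in_frac_ideal)
  with sub have "mat n n (\<lambda>(i, j). \<pi> powi \<mu> i j) \<in> tiled_order n \<mu>'" by blast
  then show "\<forall>i<n. \<forall>j<n. \<mu>' i j \<le> \<mu> i j" by (simp add: tiled_order_def powi_in_frac_ideal)
next
  assume "\<forall>i<n. \<forall>j<n. \<mu>' i j \<le> \<mu> i j"
  then show "tiled_order n \<mu> \<subseteq> tiled_order n \<mu>'"
    by (auto simp: tiled_order_def) (metis frac_ideal_mono)
qed

section \<open>Maximal orders and their intersections\<close>

lemma is_maximal_order_conj:
  assumes gh: "inverse_pair n g h" and S: "is_maximal_order v n S"
  shows "is_maximal_order v n ((\<lambda>A. g * A * h) ` S)"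
proof -
  note hg = inverse_pair_sym[OF gh]
  have ord: "is_order v n S" using S by (simp add: is_maximal_order_def)
  have "T = (\<lambda>A. g * A * h) ` S" if T: "is_order v n T" "(\<lambda>A. g * A * h) ` S \<subseteq> T" for T
  proof -
    \<comment> \<open>Conjugating back turns an order above the conjugate into an order above
      \<open>S\<close>, where maximality applies.\<close>
    have "S \<subseteq> (\<lambda>A. h * A * g) ` T"
      using image_mono[OF T(2), of "\<lambda>A. h * A * g"]
        conj_image_conj_image[OF gh is_order_subset[OF ord]] by simp
    then have "(\<lambda>A. h * A * g) ` T = S"
      using S is_order_conj[OF hg T(1)] by (simp add: is_maximal_order_def)
    then show ?thesis using conj_image_conj_image[OF hg is_order_subset[OF T(1)]] by simp
  qed
  then show ?thesis using is_order_conj[OF gh ord] by (simp add: is_maximal_order_def)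
qed

lemma exponent_matrix_point: "exponent_matrix n (\<lambda>i j. m $ i - m $ j)"
  by (simp add: exponent_matrix_def)

text \<open>An order above this one contains the diagonal ring, so it is tiled with some smaller or
  equal exponents \<open>\<mu>\<close>. Since \<open>\<mu> i j + \<mu> j i\<close> is nonnegative
  while \<open>m $ i - m $ j\<close> is antisymmetric, no exponent can actually drop.\<close>

lemma is_maximal_order_point: "is_maximal_order v n (tiled_order n (\<lambda>i j. m $ i - m $ j))"
proof -
  have "T = tiled_order n (\<lambda>i j. m $ i - m $ j)"
    if T: "is_order v n T" "tiled_order n (\<lambda>i j. m $ i - m $ j) \<subseteq> T" for T
  proof -
    have "diagonal_ring v n \<subseteq> T"
      using diagonal_subset_tiled_order[OF exponent_matrix_point] T(2) by blast
    then obtain \<mu> where \<mu>: "exponent_matrix n \<mu>" and T_eq: "T = tiled_order n \<mu>"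
      using order_containing_diagonal[OF T(1)] by blast
    have "m $ i - m $ j \<le> \<mu> i j" if ij: "i < n" "j < n" for i j
    proof -
      have "\<mu> j i \<le> m $ j - m $ i"
        using T(2) ij by (simp add: T_eq tiled_order_subset_iff)
      moreover have "0 \<le> \<mu> i j + \<mu> j i"
        using \<mu> ij unfolding exponent_matrix_def by metis
      ultimately show ?thesis by linarith
    qed
    then have "T \<subseteq> tiled_order n (\<lambda>i j. m $ i - m $ j)"
      by (simp add: T_eq tiled_order_subset_iff)
    with T(2) show ?thesis by blast
  qed
  then show ?thesis
    using tiled_order_is_order[OF exponent_matrix_point] by (simp add: is_maximal_order_def)
qed

text \<open>Every lattice point respects the bounds \<open>\<nu>\<close>, which gives one inclusion.
  For the other, each bound is attained at a vertex, whose order already forces the condition on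
  that entry.\<close>

lemma Inter_points:
  assumes n: "1 \<le> n" and ex: "exponent_matrix n (\<lambda>i j. \<nu> $$ (i, j))"
  shows "(\<Inter>m\<in>polytope_lattice_points n \<nu>. tiled_order n (\<lambda>i j. m $ i - m $ j)) =
    tiled_order n (\<lambda>i j. \<nu> $$ (i, j))"
proof (intro equalityI subsetI)
  fix A assume A: "A \<in> (\<Inter>m\<in>polytope_lattice_points n \<nu>. tiled_order n (\<lambda>i j. m $ i - m $ j))"
  note vertex = exponent_matrix_vertex[OF n ex]
  have "A \<in> carrier_mat n n" using A vertex[of 0] n by (auto simp: tiled_order_def)
  moreover have "A $$ (i, j) \<in> frac_ideal v (\<nu> $$ (i, j))" if ij: "i < n" "j < n" for i j
  proof -
    obtain m where "m \<in> polytope_lattice_points n \<nu>" "m $ i - m $ j = \<nu> $$ (i, j)"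
      using vertex[OF ij(2)] ij by blast
    then show ?thesis using A ij unfolding tiled_order_def by force
  qed
  ultimately show "A \<in> tiled_order n (\<lambda>i j. \<nu> $$ (i, j))" by (simp add: tiled_order_def)
next
  fix A assume A: "A \<in> tiled_order n (\<lambda>i j. \<nu> $$ (i, j))"
  have "tiled_order n (\<lambda>i j. \<nu> $$ (i, j)) \<subseteq> tiled_order n (\<lambda>i j. m $ i - m $ j)"
    if "m \<in> polytope_lattice_points n \<nu>" for m
    using that by (simp add: tiled_order_subset_iff polytope_lattice_points_iff[OF n])
  with A show "A \<in> (\<Inter>m\<in>polytope_lattice_points n \<nu>. tiled_order n (\<lambda>i j. m $ i - m $ j))" by blast
qed

text \<open>A maximal order above the tiled order is itself tiled. Any lattice point of its own
  polytope gives an order containing it, and maximality makes the two equal.\<close>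

lemma maximal_orders_containing_tiled_order:
  assumes n: "1 \<le> n" and ex: "exponent_matrix n (\<lambda>i j. \<nu> $$ (i, j))"
  shows "is_maximal_order v n T \<and> tiled_order n (\<lambda>i j. \<nu> $$ (i, j)) \<subseteq> T \<longleftrightarrow>
    (\<exists>m\<in>polytope_lattice_points n \<nu>. T = tiled_order n (\<lambda>i j. m $ i - m $ j))"
    (is "?l \<longleftrightarrow> ?r")
proof
  assume ?l
  then have T: "is_order v n T" and max: "\<And>T'. is_order v n T' \<Longrightarrow> T \<subseteq> T' \<Longrightarrow> T' = T"
    and sub: "tiled_order n (\<lambda>i j. \<nu> $$ (i, j)) \<subseteq> T"
    by (auto simp: is_maximal_order_def)
  have "diagonal_ring v n \<subseteq> T" using diagonal_subset_tiled_order[OF ex] sub by blast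
  then obtain \<mu> where \<mu>: "exponent_matrix n \<mu>" and T_eq: "T = tiled_order n \<mu>"
    using order_containing_diagonal[OF T] by blast
  \<comment> \<open>Packing \<open>\<mu>\<close> into a matrix makes the polytope lemmas available;
    they supply a lattice point \<open>m\<close>.\<close>
  define M where "M = mat n n (\<lambda>(i, j). \<mu> i j)"
  have "exponent_matrix n (\<lambda>i j. M $$ (i, j))"
    using \<mu> by (simp add: exponent_matrix_def M_def)
  from exponent_matrix_vertex[OF n this, of 0] n
  obtain m where m: "m \<in> polytope_lattice_points n M" by auto
  have "T \<subseteq> tiled_order n (\<lambda>i j. m $ i - m $ j)"
    using m by (simp add: T_eq tiled_order_subset_iff polytope_lattice_points_iff[OF n] M_def)
  then have T_m: "T = tiled_order n (\<lambda>i j. m $ i - m $ j)"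
    by (rule sym[OF max[OF tiled_order_is_order[OF exponent_matrix_point]]])
  \<comment> \<open>The normalization of \<open>m\<close> comes from the polytope of
    \<open>M\<close>, the bounds by \<open>\<nu>\<close> from the inclusion
    \<open>sub\<close>.\<close>
  have "m \<in> polytope_lattice_points n \<nu>"
    using m sub by (simp add: T_m tiled_order_subset_iff polytope_lattice_points_iff[OF n])
  with T_m show ?r by blast
next
  assume ?r
  then show ?l using is_maximal_order_point Inter_points[OF n ex] by blast
qed

section \<open>Polytopes and split orders in arbitrary apartments\<close>

text \<open>The body repeats the set in \<open>is_convex_polytope_in_apartment\<close> literally, so
  that it can be folded there.\<close>

definition apartment_polytope :: "nat \<Rightarrow> 'k mat \<Rightarrow> int mat \<Rightarrow> 'k mat set set" where
  "apartment_polytope n g \<nu> =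
     {lattice_End n ((*\<^sub>v) g ` coordinate_lattice v \<pi> n m) | m. m \<in> polytope_lattice_points n \<nu>}"

lemma apartment_polytope_eq:
  assumes "inverse_pair n g h"
  shows "apartment_polytope n g \<nu> =
    (\<lambda>m. (\<lambda>A. g * A * h) ` tiled_order n (\<lambda>i j. m $ i - m $ j)) ` polytope_lattice_points n \<nu>"
proof -
  have "lattice_End n ((*\<^sub>v) g ` coordinate_lattice v \<pi> n m) =
      (\<lambda>A. g * A * h) ` tiled_order n (\<lambda>i j. m $ i - m $ j)" for m
    by (subst lattice_End_conj[OF assms])
      (auto simp: coordinate_lattice_eq simp flip: lattice_End_coordinate_lattice)
  then show ?thesis by (auto simp: apartment_polytope_def)
qed

lemma Inter_apartment_polytope:
  assumes n: "1 \<le> n" and gh: "inverse_pair n g h" and ex: "exponent_matrix n (\<lambda>i j. \<nu> $$ (i, j))"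
  shows "(\<Inter>\<Lambda>\<in>apartment_polytope n g \<nu>. \<Lambda>) = (\<lambda>A. g * A * h) ` tiled_order n (\<lambda>i j. \<nu> $$ (i, j))"
proof -
  \<comment> \<open>Conjugation commutes with the intersection because it is injective and the index
    set is nonempty; \<open>m\<close> witnesses the latter.\<close>
  obtain m where "m \<in> polytope_lattice_points n \<nu>"
    using exponent_matrix_vertex[OF n ex, of 0] n by auto
  then have "(\<lambda>A. g * A * h) ` (\<Inter>m\<in>polytope_lattice_points n \<nu>. tiled_order n (\<lambda>i j. m $ i - m $ j)) =
      (\<Inter>m\<in>polytope_lattice_points n \<nu>. (\<lambda>A. g * A * h) ` tiled_order n (\<lambda>i j. m $ i - m $ j))"
    by (intro image_INT[OF conj_inj_on[OF gh]]) (auto simp: tiled_order_def)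
  then show ?thesis by (simp add: apartment_polytope_eq[OF gh] Inter_points[OF n ex])
qed

text \<open>The right-hand side depends on \<open>g\<close> and \<open>\<nu>\<close> only through
  the conjugated tiled order. Hence the polytope can be recovered from its intersection, whichever
  frame described it.\<close>

lemma apartment_polytope_eq_maximal_orders:
  assumes n: "1 \<le> n" and gh: "inverse_pair n g h" and ex: "exponent_matrix n (\<lambda>i j. \<nu> $$ (i, j))"
  shows "apartment_polytope n g \<nu> =
    {T. is_maximal_order v n T \<and> (\<lambda>A. g * A * h) ` tiled_order n (\<lambda>i j. \<nu> $$ (i, j)) \<subseteq> T}"
proof (intro equalityI subsetI)
  fix T assume "T \<in> apartment_polytope n g \<nu>"
  then obtain m where m: "m \<in> polytope_lattice_points n \<nu>"
    and T: "T = (\<lambda>A. g * A * h) ` tiled_order n (\<lambda>i j. m $ i - m $ j)"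
    by (auto simp: apartment_polytope_eq[OF gh])
  then have "tiled_order n (\<lambda>i j. \<nu> $$ (i, j)) \<subseteq> tiled_order n (\<lambda>i j. m $ i - m $ j)"
    using maximal_orders_containing_tiled_order[OF n ex] by blast
  then show "T \<in> {T. is_maximal_order v n T \<and>
      (\<lambda>A. g * A * h) ` tiled_order n (\<lambda>i j. \<nu> $$ (i, j)) \<subseteq> T}"
    using is_maximal_order_conj[OF gh is_maximal_order_point] unfolding T by blast
next
  note hg = inverse_pair_sym[OF gh]
  fix T assume "T \<in> {T. is_maximal_order v n T \<and>
      (\<lambda>A. g * A * h) ` tiled_order n (\<lambda>i j. \<nu> $$ (i, j)) \<subseteq> T}"
  then have T: "is_maximal_order v n T"
    and sub: "(\<lambda>A. g * A * h) ` tiled_order n (\<lambda>i j. \<nu> $$ (i, j)) \<subseteq> T" by auto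
  have Tc: "T \<subseteq> carrier_mat n n" using T is_order_subset[of v n T] by (simp add: is_maximal_order_def)
  have "tiled_order n (\<lambda>i j. \<nu> $$ (i, j)) \<subseteq> carrier_mat n n" by (auto simp: tiled_order_def)
  then have "tiled_order n (\<lambda>i j. \<nu> $$ (i, j)) \<subseteq> (\<lambda>A. h * A * g) ` T"
    using image_mono[OF sub, of "\<lambda>A. h * A * g"] conj_image_conj_image[OF gh] by simp
  then obtain m where "m \<in> polytope_lattice_points n \<nu>"
    and "(\<lambda>A. h * A * g) ` T = tiled_order n (\<lambda>i j. m $ i - m $ j)"
    using maximal_orders_containing_tiled_order[OF n ex, of "(\<lambda>A. h * A * g) ` T"]
      is_maximal_order_conj[OF hg T] by blast
  moreover from this(2) have "T = (\<lambda>A. g * A * h) ` tiled_order n (\<lambda>i j. m $ i - m $ j)"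
    using conj_image_conj_image[OF hg Tc] by simp
  ultimately show "T \<in> apartment_polytope n g \<nu>"
    by (auto simp: apartment_polytope_eq[OF gh])
qed

text \<open>Maximality of the members comes from
  \<open>apartment_polytope_eq_maximal_orders\<close>, and reducedness is rewritten by
  \<open>is_reduced_iff\<close>. The result has the same parameters as
  \<open>is_split_order_iff\<close>.\<close>

lemma is_convex_polytope_in_apartment_iff:
  assumes n: "1 \<le> n"
  shows "is_convex_polytope_in_apartment v \<pi> n P \<longleftrightarrow>
    (\<exists>g\<in>Units (matrix_ring n). \<exists>\<nu>\<in>carrier_mat n n.
       exponent_matrix n (\<lambda>i j. \<nu> $$ (i, j)) \<and> P = apartment_polytope n g \<nu>)"
proof -
  have "is_maximal_order v n \<Lambda>"
    if "g \<in> Units (matrix_ring n)" "exponent_matrix n (\<lambda>i j. \<nu> $$ (i, j))"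
      "\<Lambda> \<in> apartment_polytope n g \<nu>" for g \<nu> \<Lambda>
    using that apartment_polytope_eq_maximal_orders[OF n inverse_pair_Units] by blast
  then show ?thesis
    unfolding is_convex_polytope_in_apartment_def is_reduced_iff[OF n] apartment_polytope_def[symmetric]
    by blast
qed

text \<open>Conjugating the diagonal ring back to standard position allows
  \<open>order_containing_diagonal\<close> to be applied. Split orders and polytopes are thereby
  described by the same pairs \<open>g\<close> and \<open>\<nu>\<close>.\<close>

lemma is_split_order_iff:
  "is_split_order v n S \<longleftrightarrow>
    (\<exists>g\<in>Units (matrix_ring n). \<exists>\<nu>\<in>carrier_mat n n. exponent_matrix n (\<lambda>i j. \<nu> $$ (i, j)) \<and>
       S = (\<lambda>A. g * A * inv\<^bsub>matrix_ring n\<^esub> g) ` tiled_order n (\<lambda>i j. \<nu> $$ (i, j)))"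
    (is "?l \<longleftrightarrow> ?r")
proof
  assume ?l
  then obtain g where S: "is_order v n S" and g: "g \<in> Units (matrix_ring n)"
    and sub: "(\<lambda>d. g * d * inv\<^bsub>matrix_ring n\<^esub> g) ` diagonal_ring v n \<subseteq> S"
    by (auto simp: is_split_order_def)
  let ?h = "inv\<^bsub>matrix_ring n\<^esub> g"
  note gh = inverse_pair_Units[OF g]
  note hg = inverse_pair_sym[OF gh]
  have "diagonal_ring v n \<subseteq> carrier_mat n n" by (auto simp: diagonal_ring_def)
  then have "diagonal_ring v n \<subseteq> (\<lambda>A. ?h * A * g) ` S"
    using image_mono[OF sub, of "\<lambda>A. ?h * A * g"] conj_image_conj_image[OF gh] by simp
  then obtain \<mu> where \<mu>: "exponent_matrix n \<mu>" and S_eq: "(\<lambda>A. ?h * A * g) ` S = tiled_order n \<mu>"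
    using order_containing_diagonal[OF is_order_conj[OF hg S]] by blast
  define \<nu> where "\<nu> = mat n n (\<lambda>(i, j). \<mu> i j)"
  have "exponent_matrix n (\<lambda>i j. \<nu> $$ (i, j))" "tiled_order n \<mu> = tiled_order n (\<lambda>i j. \<nu> $$ (i, j))"
    using \<mu> by (auto simp: exponent_matrix_def tiled_order_def \<nu>_def)
  moreover have "S = (\<lambda>A. g * A * ?h) ` tiled_order n \<mu>"
    using conj_image_conj_image[OF hg is_order_subset[OF S]] S_eq by simp
  ultimately show ?r using g by (intro bexI[of _ g] bexI[of _ \<nu>]) (auto simp: \<nu>_def)
next
  assume ?r
  then obtain g \<nu> where g: "g \<in> Units (matrix_ring n)" and ex: "exponent_matrix n (\<lambda>i j. \<nu> $$ (i, j))"
    and S: "S = (\<lambda>A. g * A * inv\<^bsub>matrix_ring n\<^esub> g) ` tiled_order n (\<lambda>i j. \<nu> $$ (i, j))" by blast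
  have "is_order v n S"
    unfolding S by (rule is_order_conj[OF inverse_pair_Units[OF g] tiled_order_is_order[OF ex]])
  moreover have "(\<lambda>A. g * A * inv\<^bsub>matrix_ring n\<^esub> g) ` diagonal_ring v n \<subseteq> S"
    unfolding S by (intro image_mono diagonal_subset_tiled_order ex)
  ultimately show ?l
    using g unfolding is_split_order_def Setcompr_eq_image by blast
qed

end

theorem theorem3p11:
  fixes v :: "'k::field \<Rightarrow> int" and \<pi> :: 'k and n :: nat
  assumes "nonarch_local_field v" and "uniformizer v \<pi>" and "1 \<le> n"
  shows "bij_betw (\<lambda>P. \<Inter>\<Lambda>\<in>P. \<Lambda>)
           {P. is_convex_polytope_in_apartment v \<pi> n P}
           {S. is_split_order v n S}"
proof -
  interpret discrete_valuation v \<pi>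
    using assms(1,2) by (simp add: discrete_valuation_def nonarch_local_field_def)
  note n = assms(3)
  \<comment> \<open>The candidate inverse map, defined without reference to any frame.\<close>
  let ?over = "\<lambda>S. {T. is_maximal_order v n T \<and> S \<subseteq> T}"
  \<comment> \<open>Both maps evaluated on the common parameters \<open>g\<close> and
    \<open>\<nu>\<close>; the two round trips then reduce to rewriting with these equations.\<close>
  have poly: "(\<Inter>\<Lambda>\<in>apartment_polytope n g \<nu>. \<Lambda>) =
        (\<lambda>A. g * A * inv\<^bsub>matrix_ring n\<^esub> g) ` tiled_order n (\<lambda>i j. \<nu> $$ (i, j))"
      "?over ((\<lambda>A. g * A * inv\<^bsub>matrix_ring n\<^esub> g) ` tiled_order n (\<lambda>i j. \<nu> $$ (i, j))) =
        apartment_polytope n g \<nu>"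
    if "g \<in> Units (matrix_ring n)" "exponent_matrix n (\<lambda>i j. \<nu> $$ (i, j))" for g \<nu>
    using Inter_apartment_polytope[OF n inverse_pair_Units[OF that(1)] that(2)]
      apartment_polytope_eq_maximal_orders[OF n inverse_pair_Units[OF that(1)] that(2)]
    by auto
  show ?thesis
  proof (rule bij_betw_byWitness[where f' = ?over])
    show "\<forall>P\<in>{P. is_convex_polytope_in_apartment v \<pi> n P}. ?over (\<Inter>\<Lambda>\<in>P. \<Lambda>) = P"
    proof
      fix P assume "P \<in> {P. is_convex_polytope_in_apartment v \<pi> n P}"
      then obtain g \<nu> where "g \<in> Units (matrix_ring n)" "exponent_matrix n (\<lambda>i j. \<nu> $$ (i, j))"
        and P: "P = apartment_polytope n g \<nu>"
        unfolding is_convex_polytope_in_apartment_iff[OF n] by blast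
      then show "?over (\<Inter>\<Lambda>\<in>P. \<Lambda>) = P" by (simp only: P poly)
    qed
    show "\<forall>S\<in>{S. is_split_order v n S}. (\<Inter>\<Lambda>\<in>?over S. \<Lambda>) = S"
    proof
      fix S assume "S \<in> {S. is_split_order v n S}"
      then obtain g \<nu> where "g \<in> Units (matrix_ring n)" "exponent_matrix n (\<lambda>i j. \<nu> $$ (i, j))"
        and S: "S = (\<lambda>A. g * A * inv\<^bsub>matrix_ring n\<^esub> g) ` tiled_order n (\<lambda>i j. \<nu> $$ (i, j))"
        unfolding is_split_order_iff by blast
      then show "(\<Inter>\<Lambda>\<in>?over S. \<Lambda>) = S" by (simp only: S poly)
    qed
    show "(\<lambda>P. \<Inter>\<Lambda>\<in>P. \<Lambda>) ` {P. is_convex_polytope_in_apartment v \<pi> n P} \<subseteq> {S. is_split_order v n S}"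
      unfolding is_convex_polytope_in_apartment_iff[OF n] is_split_order_iff using poly(1) by blast
    show "?over ` {S. is_split_order v n S} \<subseteq> {P. is_convex_polytope_in_apartment v \<pi> n P}"
      unfolding is_convex_polytope_in_apartment_iff[OF n] is_split_order_iff using poly(2) by blast
  qed
qed

end
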